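(* Let $k\ge 2$ and let $m,r\ge 0$ be integers with $m+r=k-2$. Then for the HC-model there exists $\lambda_{cr}$ such that the following statements are true: 1. for $0<\lambda<\lambda_{cr}$ there is a unique AGM (with parameters $m,r$), and it coincides with the only TIGM $\mu_0$; 2. if $m=r$ and $\lambda=\lambda_{cr}$, then there is a unique AGM, and it coincides with the only TIGM $\mu_0$; 3. if $m\ne r$ and $\lambda=\lambda_{cr}$, then there is at least one AGM that is not TI; 4. for $\lambda>\lambda_{cr}$ there are exactly three Gibbs measures $\mu_0$, $\mu_1$ and $\mu_2$ (corresponding to solutions $(h,l)$ for the parameters $m,r$), where $\mu_1$ and $\mu_2$ are AGMs that are not TI.
   Context: Half-tree: let $V$ be the vertex set of the infinite rooted tree with root $x^0$ in which every vertex $x$ has exactly $k$ direct successors, forming the set $S(x)$ (so the root has $k$ nearest neighbours and every other vertex has $k+1$). $W_n$ is the set of vertices at distance $n$ from $x^0$, and $V_n=\bigcup_{j=0}^n W_j$. HC-model (hard-core model): a configuration $\sigma: V\to\{0,1\}$ is admissible if $\sigma(x)\sigma(y)=0$ for all nearest neighbours $x,y$; $\Omega$ (resp. $\Omega_{V_n}$) is the set of admissible configurations on $V$ (resp. $V_n$). For $\sigma_n\in\Omega_{V_n}$, $\#\sigma_n$ is the number of $x\in V_n$ with $\sigma_n(x)=1$. For $\lambda>0$ and a positive function $z: x\mapsto z_x$ on $V$, put $z_{0,x}=1$, $z_{1,x}=z_x$ and $\mu^{(n)}(\sigma_n)=\frac1{Z_n}\lambda^{\#\sigma_n}\prod_{x\in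 W_n}z_{\sigma_n(x),x}$ on $\Omega_{V_n}$, with $Z_n$ the normalizing constant. If $z_x=\prod_{y\in S(x)}(1+\lambda z_y)^{-1}$ for all $x\in V$, these measures are consistent and define a unique probability measure on $\Omega$ with marginals $\mu^{(n)}$, the (splitting) Gibbs measure corresponding to $z$. It is translation-invariant (a TIGM) if $z_x$ is constant; for each $\lambda>0$ the TIGM exists and is unique. Alternative Gibbs measures (AGM) with parameters $m,r$ ($0\le m,r\le k$ integers): consider functions $z$ taking values in $\{h,l\}$ such that if $z_x=h$ then $z_y=h$ on $m$ vertices $y$ of $S(x)$ and $z_y=l$ on the remaining $k-m$; and if $z_x=l$ then $z_y=l$ on $r$ vertices $y$ of $S(x)$ and $z_y=h$ on the remaining $k-r$. The arrangement (which vertices get the symbol $h$ and which $l$) is fixed. Such $z$ satisfies the equation above when $h>0$, $l>0$ solve $$h=\frac{1}{(1+\lambda h)^m(1+\lambda l)^{k-m}},\qquad l=\frac{1}{(1+\lambda l)^r(1+\lambda h)^{k-r}}.$$ The AGMs are the Gibbs measures corresponding to the solutions $(h,l)$ of this system, one for each solution; solutions with $h=l$ give the TIGM, and solutions with $h\ne l$ give AGMs which are "not TI".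
   Formalization: Statement 4 is false at λ=2^k when m≠r (there one solution on the second branch has h=l), so it is proved for all λ>λ_cr with λ≠2^k; at λ=2^k>λ_cr there are exactly two measures, μ_0 and one AGM that is not TI. *)

theory Defs
  imports "HOL-Probability.Probability"
begin

(* A vertex of the half-tree is the list of child indices (each < k) on the path from the
   root, last step first; so the root is [] and the distance from the root is the length. *)
type_synonym vertex = "nat list"

definition vertices :: "nat \<Rightarrow> vertex set" where
  "vertices k = lists {..<k}"

definition successors :: "nat \<Rightarrow> vertex \<Rightarrow> vertex set" where
  "successors k x = (\<lambda>i. i # x) ` {..<k}"

definition nearest_neighbours :: "nat \<Rightarrow> vertex \<Rightarrow> vertex \<Rightarrow> bool" where
  "nearest_neighbours k x y \<longleftrightarrow> y \<in> successors k x \<or> x \<in> successors k y"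

definition sphere_W :: "nat \<Rightarrow> nat \<Rightarrow> vertex set" where
  "sphere_W k n = {x \<in> vertices k. length x = n}"

definition ball_V :: "nat \<Rightarrow> nat \<Rightarrow> vertex set" where
  "ball_V k n = (\<Union>j\<le>n. sphere_W k j)"

text \<open>Configurations on a vertex set \<open>A\<close> are extensional functions, so that equality of
  configurations is equality on \<open>A\<close>.\<close>

definition hc_configs :: "nat \<Rightarrow> vertex set \<Rightarrow> (vertex \<Rightarrow> nat) set" where
  "hc_configs k A = {\<sigma> \<in> A \<rightarrow>\<^sub>E {0, 1}.
     \<forall>x\<in>A. \<forall>y\<in>A. nearest_neighbours k x y \<longrightarrow> \<sigma> x * \<sigma> y = 0}"

definition hc_weight :: "nat \<Rightarrow> real \<Rightarrow> (vertex \<Rightarrow> real) \<Rightarrow> nat \<Rightarrow> (vertex \<Rightarrow> nat) \<Rightarrow> real" where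
  "hc_weight k lam z n \<sigma> =
     lam ^ card {x \<in> ball_V k n. \<sigma> x = 1} * (\<Prod>x\<in>sphere_W k n. (if \<sigma> x = 1 then z x else 1))"

definition finite_volume :: "nat \<Rightarrow> real \<Rightarrow> (vertex \<Rightarrow> real) \<Rightarrow> nat \<Rightarrow> (vertex \<Rightarrow> nat) \<Rightarrow> real" where
  "finite_volume k lam z n \<sigma> =
     hc_weight k lam z n \<sigma> / (\<Sum>\<tau>\<in>hc_configs k (ball_V k n). hc_weight k lam z n \<tau>)"

definition config_space :: "nat \<Rightarrow> (vertex \<Rightarrow> nat) measure" where
  "config_space k =
     restrict_space (\<Pi>\<^sub>M x\<in>vertices k. count_space {0, 1}) (hc_configs k (vertices k))"

text \<open>Of a function \<open>z\<close> on vertices only the values on \<^term>\<open>vertices k\<close> matter, and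
  of the measure \<^term>\<open>config_space k\<close> only the sigma-algebra.\<close>

definition boundary_law :: "nat \<Rightarrow> real \<Rightarrow> (vertex \<Rightarrow> real) \<Rightarrow> bool" where
  "boundary_law k lam z \<longleftrightarrow>
     (\<forall>x\<in>vertices k. z x > 0 \<and> z x = (\<Prod>y\<in>successors k x. inverse (1 + lam * z y)))"

definition gibbs_measure :: "nat \<Rightarrow> real \<Rightarrow> (vertex \<Rightarrow> real) \<Rightarrow> (vertex \<Rightarrow> nat) measure \<Rightarrow> bool" where
  "gibbs_measure k lam z \<mu> \<longleftrightarrow>
     boundary_law k lam z \<and> prob_space \<mu> \<and> sets \<mu> = sets (config_space k) \<and>
     (\<forall>n. \<forall>\<sigma>\<in>hc_configs k (ball_V k n).
        measure \<mu> {\<omega> \<in> space \<mu>. restrict \<omega> (ball_V k n) = \<sigma>} = finite_volume k lam z n \<sigma>)"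

definition TIGM :: "nat \<Rightarrow> real \<Rightarrow> (vertex \<Rightarrow> nat) measure set" where
  "TIGM k lam = {\<mu>. \<exists>c. gibbs_measure k lam (\<lambda>_. c) \<mu>}"

datatype symbol = H | L

definition arrangement :: "nat \<Rightarrow> nat \<Rightarrow> nat \<Rightarrow> (vertex \<Rightarrow> symbol) \<Rightarrow> bool" where
  "arrangement k m r s \<longleftrightarrow>
     (\<forall>x\<in>vertices k.
        (s x = H \<longrightarrow> card {y \<in> successors k x. s y = H} = m \<and>
                     card {y \<in> successors k x. s y = L} = k - m) \<and>
        (s x = L \<longrightarrow> card {y \<in> successors k x. s y = L} = r \<and>
                     card {y \<in> successors k x. s y = H} = k - r))"

definition agm_solution :: "nat \<Rightarrow> nat \<Rightarrow> nat \<Rightarrow> real \<Rightarrow> real \<Rightarrow> real \<Rightarrow> bool" where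
  "agm_solution k m r lam h l \<longleftrightarrow> h > 0 \<and> l > 0 \<and>
     h = 1 / ((1 + lam * h) ^ m * (1 + lam * l) ^ (k - m)) \<and>
     l = 1 / ((1 + lam * l) ^ r * (1 + lam * h) ^ (k - r))"

definition AGM :: "nat \<Rightarrow> nat \<Rightarrow> nat \<Rightarrow> (vertex \<Rightarrow> symbol) \<Rightarrow> real \<Rightarrow> (vertex \<Rightarrow> nat) measure set" where
  "AGM k m r s lam = {\<mu>. \<exists>h l. agm_solution k m r lam h l \<and>
     gibbs_measure k lam (\<lambda>x. case s x of H \<Rightarrow> h | L \<Rightarrow> l) \<mu>}"

(* Pitfall at the activity 2^k. If m + r = k - 2, the system says that h = l or
   lam^2 h l = 1; on the second branch, with a = lam h, it becomes
   (1 + a)^k = lam a^(r + 1). Both branches contain a = 1 exactly for lam = 2^k, where the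
   solution h = l = 2^(-k) replaces one of the two solutions with h \<noteq> l. So for m \<noteq> r,
   when 2^k lies above the critical value, there are two solutions at 2^k and not three. *)

end

theory Submission
  imports Defs
begin

text \<open>
  The theorem follows from two independent facts.

  The measures are in bijection with the solutions \<open>(h, l)\<close>. For a boundary law \<open>z\<close> a Gibbs measure
  is obtained without an extension theorem for consistent families: toss independent coins
  with odds \<open>lam * z x\<close> to \<open>1\<close> at all vertices and, going outwards from the root, let a vertex keep
  its particle only if its predecessor is empty. The probability of a configuration on a ball is
  then a product over the vertices with an empty predecessor, and the equation for \<open>z\<close> says exactly
  that the factors of the blocked vertices can be traded for those \<open>z x\<close> with \<open>x\<close> occupied inside
  the ball (\<open>gibbs_measure_exists\<close>). The measure is unique, because the events prescribed on balls
  form a generating \<open>\<inter>\<close>-stable family (\<open>gibbs_measure_unique\<close>). Conversely the measure determines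
  \<open>z\<close>, because the odds of the configuration with a single particle at \<open>x\<close>, on the boundary of a
  ball, against the empty one are \<open>lam * z x\<close> (\<open>gibbs_measure_determines_boundary_law\<close>). Since
  \<open>m, r < k\<close>, both symbols occur in every arrangement, so distinct solutions give distinct
  boundary laws, and exactly those with \<open>h = l\<close> give a translation-invariant measure.

  The solutions can be counted by hand. The quotient of the two equations forces \<open>h = l\<close> or
  \<open>lam\<^sup>2 * h * l = 1\<close> (\<open>agm_solution_quotient\<close>). The diagonal contains one solution by monotonicity. On the
  hyperbola, \<open>a = lam * h\<close> satisfies \<open>lam = (1 + a) ^ k / a ^ (r + 1)\<close>. The right-hand side decreases
  from infinity to its minimum at \<open>a = (r + 1) / (m + 1)\<close> and increases to infinity afterwards, so
  the critical activity is this minimum: below it there are no solutions on the hyperbola, at it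
  there is one, above it there are two (\<open>activity_two_preimages\<close>). The hyperbola meets the diagonal at
  \<open>a = 1\<close>, which is the minimum exactly if \<open>m = r\<close>, and which has the activity \<open>2 ^ k\<close>. This explains
  the distinction at the critical activity, and the loss of one measure at \<open>2 ^ k\<close>.
\<close>

section \<open>Balls and spheres of the half-tree\<close>

lemma ball_V_eq: "ball_V k n = {x \<in> vertices k. length x \<le> n}"
  by (auto simp: ball_V_def sphere_W_def)

lemma finite_ball_V: "finite (ball_V k n)"
  using finite_lists_length_le[of "{..<k}" n]
  by (simp add: ball_V_eq vertices_def lists_eq_set)

lemma finite_sphere_W: "finite (sphere_W k n)"
  by (rule finite_subset[OF _ finite_ball_V[of k n]]) (auto simp: ball_V_eq sphere_W_def)

lemma finite_successors: "finite (successors k x)"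
  by (simp add: successors_def)

lemma ball_V_subset: "ball_V k n \<subseteq> vertices k"
  by (auto simp: ball_V_eq)

lemma ball_V_mono: "n \<le> n' \<Longrightarrow> ball_V k n \<subseteq> ball_V k n'"
  by (auto simp: ball_V_eq)

lemma Cons_in_vertices: "i # x \<in> vertices k \<longleftrightarrow> i < k \<and> x \<in> vertices k"
  by (auto simp: vertices_def)

lemma ball_V_Suc: "ball_V k (Suc n) = ball_V k n \<union> sphere_W k (Suc n)"
  by (auto simp: ball_V_eq sphere_W_def)

lemma ball_V_0: "ball_V k 0 = {[]}"
  by (auto simp: ball_V_eq vertices_def)

lemma sphere_W_0: "sphere_W k 0 = {[]}"
  by (auto simp: sphere_W_def vertices_def)

lemma sphere_W_Suc: "sphere_W k (Suc n) = (\<Union>x\<in>sphere_W k n. successors k x)"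
proof (intro set_eqI iffI)
  fix y assume "y \<in> sphere_W k (Suc n)"
  then show "y \<in> (\<Union>x\<in>sphere_W k n. successors k x)"
    by (cases y) (auto simp: sphere_W_def successors_def Cons_in_vertices)
next
  fix y assume "y \<in> (\<Union>x\<in>sphere_W k n. successors k x)"
  then show "y \<in> sphere_W k (Suc n)"
    by (auto simp: sphere_W_def successors_def Cons_in_vertices)
qed

text \<open>The spheres beyond the root are partitioned into families of siblings. A product arranged by
  families is the form in which the equation for \<open>z\<close> can be applied.\<close>

lemma prod_sphere_W_Suc:
  fixes f :: "vertex \<Rightarrow> real"
  shows "(\<Prod>y\<in>sphere_W k (Suc n). f y) = (\<Prod>x\<in>sphere_W k n. \<Prod>y\<in>successors k x. f y)"
  unfolding sphere_W_Suc
  by (rule prod.UNION_disjoint) (auto simp: finite_sphere_W finite_successors successors_def)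

lemma prod_ball_V_Suc:
  fixes f :: "vertex \<Rightarrow> real"
  shows "(\<Prod>x\<in>ball_V k (Suc n). f x) = (\<Prod>x\<in>ball_V k n. f x) * (\<Prod>x\<in>sphere_W k (Suc n). f x)"
  unfolding ball_V_Suc
  by (rule prod.union_disjoint[OF finite_ball_V finite_sphere_W]) (auto simp: ball_V_eq sphere_W_def)

section \<open>Admissible configurations and their weights\<close>

lemma finite_hc_configs: "finite A \<Longrightarrow> finite (hc_configs k A)"
  by (rule finite_subset[of _ "A \<rightarrow>\<^sub>E {0, 1}"]) (auto simp: hc_configs_def finite_PiE)

lemma restrict_hc_configs:
  assumes "\<sigma> \<in> hc_configs k B" "A \<subseteq> B"
  shows "restrict \<sigma> A \<in> hc_configs k A"
proof -
  have "restrict \<sigma> A \<in> A \<rightarrow>\<^sub>E {0, 1}"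
    using assms by (intro restrict_PiE_iff[THEN iffD2] ballI) (auto simp: hc_configs_def)
  moreover have "\<sigma> x * \<sigma> y = 0" if "x \<in> A" "y \<in> A" "nearest_neighbours k x y" for x y
    using assms that unfolding hc_configs_def by blast
  ultimately show ?thesis unfolding hc_configs_def by simp
qed

lemma hc_configs_value: "\<sigma> \<in> hc_configs k A \<Longrightarrow> x \<in> A \<Longrightarrow> \<sigma> x \<in> {0, 1}"
  unfolding hc_configs_def by blast

lemma hc_weight_prod:
  "hc_weight k lam z n \<sigma> = (\<Prod>x\<in>ball_V k n. if \<sigma> x = 1 then lam else 1) *
     (\<Prod>x\<in>sphere_W k n. if \<sigma> x = 1 then z x else 1)"
  unfolding hc_weight_def using finite_ball_V[of k n]
  by (simp add: prod.inter_filter[symmetric])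

lemma hc_weight_pos:
  assumes "lam > 0" "\<And>x. x \<in> vertices k \<Longrightarrow> z x > 0"
  shows "hc_weight k lam z n \<sigma> > 0"
  unfolding hc_weight_prod
  by (intro mult_pos_pos prod_pos) (use assms in \<open>auto simp: sphere_W_def\<close>)

lemma zero_config_hc: "(\<lambda>y\<in>A. 0) \<in> hc_configs k A"
  by (auto simp: hc_configs_def)

lemma single_config_hc: "(\<lambda>y\<in>A. if y = x then 1 else 0) \<in> hc_configs k A"
  by (auto simp: hc_configs_def nearest_neighbours_def successors_def)

lemma partition_function_pos:
  assumes "lam > 0" "\<And>x. x \<in> vertices k \<Longrightarrow> z x > 0"
  shows "(\<Sum>\<tau>\<in>hc_configs k (ball_V k n). hc_weight k lam z n \<tau>) > 0"
  using assms zero_config_hc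
  by (intro sum_pos finite_hc_configs finite_ball_V hc_weight_pos) auto

text \<open>Raising one boundary spin of the empty configuration multiplies the weight by exactly
  \<open>lam * z x\<close>; the normalizing constant cancels in the ratio. This is how the boundary law can be
  read off from the measure.\<close>

lemma finite_volume_single:
  assumes "x \<in> sphere_W k n"
  shows "finite_volume k lam z n (\<lambda>y\<in>ball_V k n. if y = x then 1 else 0) =
    lam * z x * finite_volume k lam z n (\<lambda>y\<in>ball_V k n. 0)"
proof -
  have xb: "x \<in> ball_V k n" and sub: "sphere_W k n \<subseteq> ball_V k n"
    using assms by (auto simp: ball_V_eq sphere_W_def)
  have 1: "{y \<in> ball_V k n. (\<lambda>y\<in>ball_V k n. if y = x then 1 else 0::nat) y = 1} = {x}"
    using xb by auto
  have 2: "{y \<in> ball_V k n. (\<lambda>y\<in>ball_V k n. 0::nat) y = 1} = {}" by auto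
  have 3: "(\<Prod>y\<in>sphere_W k n. if (\<lambda>y\<in>ball_V k n. if y = x then 1 else 0::nat) y = 1 then z y else 1)
     = (\<Prod>y\<in>sphere_W k n. if y = x then z y else 1)"
    using sub by (intro prod.cong) auto
  have 4: "(\<Prod>y\<in>sphere_W k n. if (\<lambda>y\<in>ball_V k n. 0::nat) y = 1 then z y else 1) = 1"
    using sub by (intro prod.neutral) auto
  show ?thesis
    unfolding finite_volume_def hc_weight_def 1 2 3 4
    using assms by (simp add: finite_sphere_W prod.delta)
qed

lemma gibbs_measure_cylinder:
  assumes "gibbs_measure k lam z \<mu>" "\<sigma> \<in> hc_configs k (ball_V k n)"
  shows "measure \<mu> {\<omega> \<in> space \<mu>. restrict \<omega> (ball_V k n) = \<sigma>} = finite_volume k lam z n \<sigma>"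
  using assms unfolding gibbs_measure_def by blast

text \<open>A single boundary spin at \<open>x\<close> has the odds \<open>lam * z x\<close> against the empty
  configuration of the ball that has \<open>x\<close> on its boundary, so the measure knows every value of \<open>z\<close>.
  Hence counting measures amounts to counting solutions of the system.\<close>

lemma gibbs_measure_determines_boundary_law:
  assumes "lam > 0" "gibbs_measure k lam z \<mu>" "gibbs_measure k lam z' \<mu>" "x \<in> vertices k"
  shows "z x = z' x"
proof -
  define n where "n = length x"
  have x: "x \<in> sphere_W k n" using assms(4) by (simp add: sphere_W_def n_def)
  let ?o = "\<lambda>y\<in>ball_V k n. 0::nat"
  have eq: "finite_volume k lam z n \<sigma> = finite_volume k lam z' n \<sigma>"
    if \<sigma>: "\<sigma> \<in> hc_configs k (ball_V k n)" for \<sigma>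
    using gibbs_measure_cylinder[OF assms(2) \<sigma>] gibbs_measure_cylinder[OF assms(3) \<sigma>] by simp
  have z: "z y > 0" if "y \<in> vertices k" for y
    using assms(2) that unfolding gibbs_measure_def boundary_law_def by blast
  have pos: "finite_volume k lam z n ?o > 0"
    unfolding finite_volume_def
    by (intro divide_pos_pos hc_weight_pos partition_function_pos assms(1) z)
  have "lam * z x * finite_volume k lam z n ?o = lam * z' x * finite_volume k lam z' n ?o"
    using eq[OF single_config_hc[where x = x]]
    by (simp only: finite_volume_single[OF x])
  then show ?thesis unfolding eq[OF zero_config_hc, symmetric] using pos assms(1) by simp
qed

section \<open>Uniqueness\<close>

lemma space_config_space: "space (config_space k) = hc_configs k (vertices k)"
  by (auto simp: config_space_def space_restrict_space space_PiM hc_configs_def)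

text \<open>Unlike product cylinders, these are indexed by balls only, so that each one is a finite
  disjoint union of the events whose probabilities the finite-volume measures prescribe.\<close>

definition cylinder :: "nat \<Rightarrow> nat \<Rightarrow> (vertex \<Rightarrow> nat) set \<Rightarrow> (vertex \<Rightarrow> nat) set" where
  "cylinder k n A = {\<omega> \<in> hc_configs k (vertices k). restrict \<omega> (ball_V k n) \<in> A}"

lemma coordinate_measurable:
  assumes "x \<in> vertices k"
  shows "(\<lambda>\<omega>. \<omega> x) \<in> config_space k \<rightarrow>\<^sub>M count_space {0, 1}"
  unfolding config_space_def
  by (rule measurable_restrict_space1) (rule measurable_component_singleton[OF assms])

lemma single_cylinder_measurable:
  assumes "\<sigma> \<in> hc_configs k (ball_V k n)"
  shows "cylinder k n {\<sigma>} \<in> sets (config_space k)"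
proof -
  have "cylinder k n {\<sigma>} = {\<omega> \<in> space (config_space k). \<forall>x\<in>ball_V k n. \<omega> x \<in> {\<sigma> x}}"
    using assms by (auto simp: cylinder_def space_config_space hc_configs_def PiE_iff
      extensional_def fun_eq_iff restrict_def)
  also have "\<dots> \<in> sets (config_space k)"
  proof (rule sets.sets_Collect_finite_All[OF _ finite_ball_V])
    fix x assume x: "x \<in> ball_V k n"
    have "\<sigma> x \<in> {0, 1}" using assms x by (rule hc_configs_value)
    then have "(\<lambda>\<omega>. \<omega> x) -` {\<sigma> x} \<inter> space (config_space k) \<in> sets (config_space k)"
      using x ball_V_subset by (intro measurable_sets[OF coordinate_measurable]) auto
    then show "{\<omega> \<in> space (config_space k). \<omega> x \<in> {\<sigma> x}} \<in> sets (config_space k)"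
      by (simp add: vimage_def Int_def conj_commute)
  qed
  finally show ?thesis .
qed

lemma cylinder_UN: "cylinder k n A = (\<Union>\<sigma>\<in>A. cylinder k n {\<sigma>})"
  by (auto simp: cylinder_def)

lemma cylinder_measurable:
  assumes "A \<subseteq> hc_configs k (ball_V k n)"
  shows "cylinder k n A \<in> sets (config_space k)"
  unfolding cylinder_UN[of k n A]
  using assms finite_subset[OF assms finite_hc_configs[OF finite_ball_V]]
  by (intro sets.finite_UN single_cylinder_measurable) auto

lemma measure_cylinder:
  assumes "gibbs_measure k lam z \<mu>" "A \<subseteq> hc_configs k (ball_V k n)"
  shows "measure \<mu> (cylinder k n A) = (\<Sum>\<sigma>\<in>A. finite_volume k lam z n \<sigma>)"
proof -
  interpret prob_space \<mu> using assms(1) by (simp add: gibbs_measure_def)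
  have fin: "finite A" using assms(2) finite_hc_configs[OF finite_ball_V] by (rule finite_subset)
  have sets: "sets \<mu> = sets (config_space k)" using assms(1) by (simp add: gibbs_measure_def)
  have sp: "space \<mu> = hc_configs k (vertices k)"
    using sets_eq_imp_space_eq[OF sets] by (simp add: space_config_space)
  have "measure \<mu> (\<Union>\<sigma>\<in>A. cylinder k n {\<sigma>}) = (\<Sum>\<sigma>\<in>A. measure \<mu> (cylinder k n {\<sigma>}))"
  proof (rule finite_measure_finite_Union[OF fin])
    show "(\<lambda>\<sigma>. cylinder k n {\<sigma>}) ` A \<subseteq> sets \<mu>"
      using assms(2) single_cylinder_measurable unfolding sets by blast
    show "disjoint_family_on (\<lambda>\<sigma>. cylinder k n {\<sigma>}) A"
      by (auto simp: disjoint_family_on_def cylinder_def)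
  qed
  also have "\<dots> = (\<Sum>\<sigma>\<in>A. finite_volume k lam z n \<sigma>)"
    using gibbs_measure_cylinder[OF assms(1)] assms(2)
    by (intro sum.cong refl) (auto simp: cylinder_def sp subset_iff)
  finally show ?thesis by (simp flip: cylinder_UN)
qed

text \<open>Raising two cylinders to the larger of their balls reduces their intersection to that of
  their bases.\<close>

lemma cylinder_raise:
  assumes "n \<le> n'"
  shows "cylinder k n A = cylinder k n' {\<tau> \<in> hc_configs k (ball_V k n'). restrict \<tau> (ball_V k n) \<in> A}"
proof -
  have "ball_V k n' \<inter> ball_V k n = ball_V k n" using ball_V_mono[OF assms] by auto
  then show ?thesis
    using restrict_hc_configs[OF _ ball_V_subset] by (auto simp: cylinder_def)
qed

definition cylinders :: "nat \<Rightarrow> (vertex \<Rightarrow> nat) set set" where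
  "cylinders k = {cylinder k n A | n A. A \<subseteq> hc_configs k (ball_V k n)}"

lemma Int_stable_cylinders: "Int_stable (cylinders k)"
proof (rule Int_stableI)
  fix a b assume "a \<in> cylinders k" "b \<in> cylinders k"
  then obtain n A n' B where a: "a = cylinder k n A" and b: "b = cylinder k n' B"
    by (auto simp: cylinders_def)
  define N where "N = max n n'"
  obtain A' B' where "a = cylinder k N A'" "b = cylinder k N B'" "A' \<subseteq> hc_configs k (ball_V k N)"
    unfolding a b using cylinder_raise[of n N k A] cylinder_raise[of n' N k B]
    by (auto simp: N_def)
  then have "a \<inter> b = cylinder k N (A' \<inter> B')" "A' \<inter> B' \<subseteq> hc_configs k (ball_V k N)"
    by (auto simp: cylinder_def)
  then show "a \<inter> b \<in> cylinders k" unfolding cylinders_def by blast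
qed

lemma whole_space_in_cylinders: "hc_configs k (vertices k) \<in> cylinders k"
proof -
  have "hc_configs k (vertices k) = cylinder k 0 (hc_configs k (ball_V k 0))"
    using restrict_hc_configs[OF _ ball_V_subset] by (auto simp: cylinder_def)
  then show ?thesis unfolding cylinders_def by blast
qed

lemma cylinders_Pow: "cylinders k \<subseteq> Pow (hc_configs k (vertices k))"
  by (auto simp: cylinders_def cylinder_def)

text \<open>Each coordinate is a function of the configuration on a ball, so the cylinders generate
  what the coordinates generate.\<close>

lemma sets_config_space: "sets (config_space k) = sigma_sets (hc_configs k (vertices k)) (cylinders k)"
proof
  let ?S = "sigma (hc_configs k (vertices k)) (cylinders k)"
  have S: "sets ?S = sigma_sets (hc_configs k (vertices k)) (cylinders k)"
    "space ?S = hc_configs k (vertices k)"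
    by (simp_all add: sets_measure_of[OF cylinders_Pow] space_measure_of[OF cylinders_Pow])
  have "(\<lambda>\<omega>. \<omega>) \<in> ?S \<rightarrow>\<^sub>M config_space k"
    unfolding config_space_def
  proof (intro measurable_restrict_space2 measurable_PiM_single')
    fix x assume x: "x \<in> vertices k"
    show "(\<lambda>\<omega>. \<omega> x) \<in> ?S \<rightarrow>\<^sub>M count_space {0, 1}"
    proof (rule measurable_count_space_eq2[THEN iffD2], simp, intro conjI ballI)
      show "(\<lambda>\<omega>. \<omega> x) \<in> space ?S \<rightarrow> {0, 1}" unfolding S using hc_configs_value x by blast
      fix a :: nat assume "a \<in> {0, 1}"
      let ?A = "{\<sigma> \<in> hc_configs k (ball_V k (length x)). \<sigma> x = a}"
      have "x \<in> ball_V k (length x)" using x by (auto simp: ball_V_eq)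
      then have "(\<lambda>\<omega>. \<omega> x) -` {a} \<inter> space ?S = cylinder k (length x) ?A"
        using restrict_hc_configs[OF _ ball_V_subset] by (auto simp: cylinder_def S)
      also have "\<dots> \<in> sets ?S" unfolding S
        by (rule sigma_sets.Basic) (auto simp: cylinders_def)
      finally show "(\<lambda>\<omega>. \<omega> x) -` {a} \<inter> space ?S \<in> sets ?S" .
    qed
  qed (unfold S, auto simp: hc_configs_def)
  then show "sets (config_space k) \<subseteq> sigma_sets (hc_configs k (vertices k)) (cylinders k)"
    using measurable_sets[of "\<lambda>\<omega>. \<omega>" ?S "config_space k"] sets.sets_into_space[of _ "config_space k"]
    by (fastforce simp: S space_config_space Int_absorb2)
  show "sigma_sets (hc_configs k (vertices k)) (cylinders k) \<subseteq> sets (config_space k)"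
    using sets.sigma_sets_subset[of "cylinders k" "config_space k"] cylinder_measurable
    by (auto simp: space_config_space cylinders_def)
qed

lemma gibbs_measure_unique:
  assumes "gibbs_measure k lam z \<mu>" "gibbs_measure k lam z \<nu>"
  shows "\<mu> = \<nu>"
proof (rule measure_eqI_generator_eq[where E = "cylinders k" and \<Omega> = "hc_configs k (vertices k)"
      and A = "\<lambda>_. hc_configs k (vertices k)"])
  interpret M: prob_space \<mu> using assms(1) by (simp add: gibbs_measure_def)
  interpret N: prob_space \<nu> using assms(2) by (simp add: gibbs_measure_def)
  show "emeasure \<mu> X = emeasure \<nu> X" if "X \<in> cylinders k" for X
    using that measure_cylinder[OF assms(1)] measure_cylinder[OF assms(2)]
    by (auto simp: cylinders_def M.emeasure_eq_measure N.emeasure_eq_measure)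
  show "emeasure \<mu> (hc_configs k (vertices k)) \<noteq> \<infinity>" by simp
qed (use assms in \<open>auto simp: Int_stable_cylinders cylinders_Pow whole_space_in_cylinders
  gibbs_measure_def sets_config_space\<close>)

section \<open>Existence\<close>

text \<open>A vertex keeps its coin exactly if its predecessor is not occupied. This thinning turns an
  arbitrary family of coin tosses \<open>U\<close> into an admissible configuration, and it is the
  construction of a splitting Gibbs measure as a Markov chain along the tree.\<close>

primrec survives :: "(vertex \<Rightarrow> bool) \<Rightarrow> vertex \<Rightarrow> bool" where
  "survives U [] \<longleftrightarrow> U []"
| "survives U (i # x) \<longleftrightarrow> U (i # x) \<and> \<not> survives U x"

primrec unblocked :: "(vertex \<Rightarrow> nat) \<Rightarrow> vertex \<Rightarrow> bool" where
  "unblocked \<sigma> [] \<longleftrightarrow> True"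
| "unblocked \<sigma> (i # x) \<longleftrightarrow> \<sigma> x \<noteq> 1"

definition thinned :: "nat \<Rightarrow> (vertex \<Rightarrow> bool) \<Rightarrow> vertex \<Rightarrow> nat" where
  "thinned k U = (\<lambda>x\<in>vertices k. of_bool (survives U x))"

lemma thinned_hc_configs: "thinned k U \<in> hc_configs k (vertices k)"
  by (auto simp: thinned_def hc_configs_def nearest_neighbours_def successors_def)

lemma ball_V_Cons: "i # x \<in> ball_V k n \<Longrightarrow> x \<in> ball_V k n"
  by (auto simp: ball_V_eq Cons_in_vertices)

lemma hc_configs_Cons_blocked:
  assumes "\<sigma> \<in> hc_configs k (ball_V k n)" "i # x \<in> ball_V k n" "\<sigma> x = 1"
  shows "\<sigma> (i # x) = 0"
proof -
  have "nearest_neighbours k x (i # x)"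
    using assms(2) by (auto simp: nearest_neighbours_def successors_def ball_V_eq Cons_in_vertices)
  then have "\<sigma> x * \<sigma> (i # x) = 0"
    using assms(1,2) ball_V_Cons[OF assms(2)] unfolding hc_configs_def by blast
  then show ?thesis using assms(3) by simp
qed

text \<open>Whether the thinned configuration agrees with \<open>\<sigma>\<close> on a ball is decided by the coins at
  the unblocked vertices, each of which must show a prescribed side. The event is therefore a
  product event, although the thinned spins are dependent.\<close>

lemma restrict_thinned_iff:
  assumes \<sigma>: "\<sigma> \<in> hc_configs k (ball_V k n)"
  shows "restrict (thinned k U) (ball_V k n) = \<sigma> \<longleftrightarrow>
    (\<forall>x\<in>ball_V k n. unblocked \<sigma> x \<longrightarrow> (U x \<longleftrightarrow> \<sigma> x = 1))"
proof -
  have val: "\<sigma> x = 0 \<or> \<sigma> x = 1" if "x \<in> ball_V k n" for x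
    using \<sigma> that by (auto simp: hc_configs_def)
  have "restrict (thinned k U) (ball_V k n) = \<sigma> \<longleftrightarrow>
      (\<forall>x\<in>ball_V k n. (of_bool (survives U x) :: nat) = \<sigma> x)"
    using \<sigma> ball_V_subset[of k n]
    by (auto simp: fun_eq_iff thinned_def hc_configs_def PiE_iff extensional_def subset_iff)
  also have "\<dots> \<longleftrightarrow> (\<forall>x\<in>ball_V k n. survives U x \<longleftrightarrow> \<sigma> x = 1)"
    using val by (intro ball_cong) force+
  also have "\<dots> \<longleftrightarrow> (\<forall>x\<in>ball_V k n. unblocked \<sigma> x \<longrightarrow> (U x \<longleftrightarrow> \<sigma> x = 1))"
  proof (rule iffI; intro ballI impI)
    fix x assume *: "\<forall>x\<in>ball_V k n. survives U x \<longleftrightarrow> \<sigma> x = 1" "x \<in> ball_V k n" "unblocked \<sigma> x"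
    show "U x \<longleftrightarrow> \<sigma> x = 1"
    proof (cases x)
      case (Cons i y)
      have "survives U y \<longleftrightarrow> \<sigma> y = 1" using * ball_V_Cons Cons by blast
      then have "\<not> survives U y" using *(3) Cons by simp
      then show ?thesis using bspec[OF *(1,2)] Cons by simp
    next
      case Nil
      then show ?thesis using bspec[OF *(1,2)] by simp
    qed
  next
    fix x assume *: "\<forall>x\<in>ball_V k n. unblocked \<sigma> x \<longrightarrow> (U x \<longleftrightarrow> \<sigma> x = 1)" "x \<in> ball_V k n"
    then show "survives U x \<longleftrightarrow> \<sigma> x = 1"
    proof (induction x)
      case (Cons i x)
      then have "survives U x \<longleftrightarrow> \<sigma> x = 1" using ball_V_Cons by blast
      moreover have "unblocked \<sigma> (i # x) \<longrightarrow> (U (i # x) \<longleftrightarrow> \<sigma> (i # x) = 1)"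
        using Cons.prems by blast
      ultimately show ?case using Cons.prems(2) hc_configs_Cons_blocked[OF \<sigma>, of i x] by auto
    qed auto
  qed
  finally show ?thesis .
qed

text \<open>The coin at \<open>x\<close> shows a particle with odds \<open>lam * z x\<close> to \<open>1\<close>, which are the conditional odds of
  occupation in the splitting Gibbs measure given that the predecessor is empty. Indexing the coins by
  all lists makes the sample space the whole type.\<close>

definition coin_measure :: "real \<Rightarrow> (vertex \<Rightarrow> real) \<Rightarrow> (vertex \<Rightarrow> bool) measure" where
  "coin_measure lam z = (\<Pi>\<^sub>M x\<in>UNIV. measure_pmf (bernoulli_pmf (lam * z x / (1 + lam * z x))))"

lemma product_prob_space_coins:
  "product_prob_space (\<lambda>x. measure_pmf (bernoulli_pmf (p x)))"
  by unfold_locales (rule prob_space_measure_pmf[THEN prob_space.emeasure_space_1] | auto)+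

lemma space_coin_measure: "space (coin_measure lam z) = UNIV"
  by (simp add: coin_measure_def space_PiM)

lemma survives_measurable:
  "(\<lambda>U. survives U x) \<in> coin_measure lam z \<rightarrow>\<^sub>M count_space UNIV"
proof -
  have coin: "(\<lambda>U. U x) \<in> coin_measure lam z \<rightarrow>\<^sub>M count_space UNIV" for x
    unfolding coin_measure_def
    by (rule measurable_compose[OF measurable_component_singleton, where g = "\<lambda>b. b"]) simp_all
  show ?thesis
  proof (induction x)
    case Nil
    show ?case using coin by simp
  next
    case (Cons i x)
    note [measurable] = Cons coin
    show ?case by simp measurable
  qed
qed

lemma thinned_measurable: "thinned k \<in> coin_measure lam z \<rightarrow>\<^sub>M config_space k"
  unfolding config_space_def
proof (intro measurable_restrict_space2 measurable_PiM_single')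
  fix x assume "x \<in> vertices k"
  have "(\<lambda>U. of_bool (survives U x)::nat) \<in> coin_measure lam z \<rightarrow>\<^sub>M count_space {0, 1}"
    by (rule measurable_compose[OF survives_measurable]) simp
  then show "(\<lambda>U. thinned k U x) \<in> coin_measure lam z \<rightarrow>\<^sub>M count_space {0, 1}"
    using \<open>x \<in> vertices k\<close> by (simp add: thinned_def)
qed (use thinned_hc_configs in \<open>auto simp: hc_configs_def\<close>)

text \<open>An occupied vertex \<open>x\<close> carries the factor \<open>z x\<close> and blocks its successors, each of
  which carries \<open>1 + lam * z y\<close>. By the boundary equation these factors multiply to \<open>1\<close>, so that
  only the factors of the outermost sphere remain.\<close>

lemma prod_unblocked_telescope:
  assumes bl: "boundary_law k lam z"
  shows "(\<Prod>x\<in>ball_V k n. (if \<sigma> x = 1 then z x else 1) * (if unblocked \<sigma> x then 1 else 1 + lam * z x))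
    = (\<Prod>x\<in>sphere_W k n. if \<sigma> x = 1 then z x else 1)"
proof (induction n)
  case 0
  show ?case unfolding ball_V_0 sphere_W_0 by simp
next
  case (Suc n)
  have "(\<Prod>x\<in>sphere_W k (Suc n). if unblocked \<sigma> x then 1 else 1 + lam * z x) =
      (\<Prod>x\<in>sphere_W k n. if \<sigma> x = 1 then inverse (z x) else 1)"
    unfolding prod_sphere_W_Suc
  proof (rule prod.cong[OF refl])
    fix x assume "x \<in> sphere_W k n"
    then have "inverse (z x) = inverse (\<Prod>y\<in>successors k x. inverse (1 + lam * z y))"
      using bl by (simp add: boundary_law_def sphere_W_def)
    then have "(\<Prod>y\<in>successors k x. 1 + lam * z y) = inverse (z x)"
      by (simp flip: prod_inversef)
    moreover have "(\<Prod>y\<in>successors k x. if unblocked \<sigma> y then 1 else 1 + lam * z y) =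
        (\<Prod>y\<in>successors k x. if \<sigma> x = 1 then 1 + lam * z y else 1)"
      by (rule prod.cong) (auto simp: successors_def)
    ultimately show "(\<Prod>y\<in>successors k x. if unblocked \<sigma> y then 1 else 1 + lam * z y) =
        (if \<sigma> x = 1 then inverse (z x) else 1)"
      by simp
  qed
  moreover have "(\<Prod>x\<in>sphere_W k n. if \<sigma> x = 1 then z x else 1) *
      (\<Prod>x\<in>sphere_W k n. if \<sigma> x = 1 then inverse (z x) else 1) = 1"
    unfolding prod.distrib[symmetric]
    using bl by (intro prod.neutral) (auto simp: boundary_law_def sphere_W_def less_imp_neq[symmetric])
  ultimately show ?case
    unfolding prod_ball_V_Suc Suc.IH prod.distrib[of _ _ "sphere_W k (Suc n)"] by simp
qed

text \<open>The product over the coins is proportional to the finite-volume weight: a blocked vertex would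
  lack its factor \<open>1 / (1 + lam * z x)\<close>, and after supplying it the compensating factors telescope.
  The constant of proportionality does not depend on \<open>\<sigma>\<close>.\<close>

lemma prob_thinned_cylinder:
  assumes bl: "boundary_law k lam z" and lam: "lam > 0"
    and \<sigma>: "\<sigma> \<in> hc_configs k (ball_V k n)"
  shows "measure (coin_measure lam z) {U. restrict (thinned k U) (ball_V k n) = \<sigma>} =
    hc_weight k lam z n \<sigma> * (\<Prod>x\<in>ball_V k n. 1 / (1 + lam * z x))"
proof -
  define p where "p x = lam * z x / (1 + lam * z x)" for x
  interpret product_prob_space "\<lambda>x. measure_pmf (bernoulli_pmf (p x))" UNIV
    by (rule product_prob_space_coins)
  let ?X = "\<lambda>x. if unblocked \<sigma> x then {\<sigma> x = 1} else UNIV"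
  have z: "z x > 0" if "x \<in> ball_V k n" for x
    using bl that ball_V_subset by (auto simp: boundary_law_def)
  have "{U. restrict (thinned k U) (ball_V k n) = \<sigma>} =
      prod_emb UNIV (\<lambda>x. measure_pmf (bernoulli_pmf (p x))) (ball_V k n) (Pi\<^sub>E (ball_V k n) ?X)"
    unfolding restrict_thinned_iff[OF \<sigma>]
    by (auto simp: prod_emb_def PiE_iff split: if_splits)
  then have "measure (coin_measure lam z) {U. restrict (thinned k U) (ball_V k n) = \<sigma>} =
      (\<Prod>x\<in>ball_V k n. measure (measure_pmf (bernoulli_pmf (p x))) (?X x))"
    unfolding coin_measure_def p_def[symmetric]
    by (simp add: measure_PiM_emb finite_ball_V)
  also have "\<dots> = (\<Prod>x\<in>ball_V k n. (if \<sigma> x = 1 then lam else 1) *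
      ((if \<sigma> x = 1 then z x else 1) * (if unblocked \<sigma> x then 1 else 1 + lam * z x)) *
      (1 / (1 + lam * z x)))"
  proof (rule prod.cong[OF refl])
    fix x assume x: "x \<in> ball_V k n"
    have D: "1 + lam * z x > 0" using lam z[OF x] by (simp add: add_pos_pos)
    have p: "0 \<le> p x" "p x \<le> 1" "1 - p x = 1 / (1 + lam * z x)"
      using D lam z[OF x] by (auto simp: p_def field_simps)
    \<comment> \<open>A blocked vertex is empty, so the first two factors are \<open>1\<close> and the last two cancel.\<close>
    have "\<sigma> x \<noteq> 1" if "\<not> unblocked \<sigma> x"
      using that x hc_configs_Cons_blocked[OF \<sigma>] by (cases x) auto
    then show "measure (measure_pmf (bernoulli_pmf (p x))) (?X x) = (if \<sigma> x = 1 then lam else 1) *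
      ((if \<sigma> x = 1 then z x else 1) * (if unblocked \<sigma> x then 1 else 1 + lam * z x)) *
      (1 / (1 + lam * z x))"
      using p D by (auto simp: measure_pmf_single p_def)
  qed
  finally show ?thesis
    unfolding prod.distrib[of _ _ "ball_V k n"] hc_weight_prod
      prod_unblocked_telescope[OF bl, of \<sigma> n, unfolded prod.distrib] .
qed

text \<open>The law of the thinned coins is a Gibbs measure. Its probabilities on a ball are proportional to
  the weights, and since they add up to \<open>1\<close> the constant must be the reciprocal of the partition
  function.\<close>

lemma gibbs_measure_exists:
  assumes bl: "boundary_law k lam z" and lam: "lam > 0"
  shows "\<exists>\<mu>. gibbs_measure k lam z \<mu>"
proof
  let ?N = "coin_measure lam z"
  let ?\<mu> = "distr ?N (config_space k) (thinned k)"
  interpret product_prob_space "\<lambda>x. measure_pmf (bernoulli_pmf (lam * z x / (1 + lam * z x)))" UNIV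
    by (rule product_prob_space_coins)
  interpret N: prob_space ?N unfolding coin_measure_def by (rule prob_space_axioms)
  have event: "{U. restrict (thinned k U) (ball_V k n) = \<sigma>} = thinned k -` cylinder k n {\<sigma>} \<inter> space ?N"
    for n \<sigma> by (auto simp: cylinder_def space_coin_measure thinned_hc_configs)
  have "measure ?\<mu> {\<omega> \<in> space ?\<mu>. restrict \<omega> (ball_V k n) = \<sigma>} = finite_volume k lam z n \<sigma>"
    if \<sigma>: "\<sigma> \<in> hc_configs k (ball_V k n)" for n \<sigma>
  proof -
    let ?E = "\<lambda>\<tau>. {U. restrict (thinned k U) (ball_V k n) = \<tau>}"
    let ?C = "\<Prod>x\<in>ball_V k n. 1 / (1 + lam * z x)"
    let ?Z = "\<Sum>\<tau>\<in>hc_configs k (ball_V k n). hc_weight k lam z n \<tau>"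
    have E: "?E \<tau> \<in> sets ?N" if "\<tau> \<in> hc_configs k (ball_V k n)" for \<tau>
      unfolding event using that
      by (intro measurable_sets[OF thinned_measurable] single_cylinder_measurable)
    have "1 = measure ?N (\<Union>\<tau>\<in>hc_configs k (ball_V k n). ?E \<tau>)"
    proof -
      have "(\<Union>\<tau>\<in>hc_configs k (ball_V k n). ?E \<tau>) = space ?N"
        using restrict_hc_configs[OF thinned_hc_configs ball_V_subset]
        by (auto simp: space_coin_measure)
      then show ?thesis by (simp add: N.prob_space)
    qed
    also have "\<dots> = (\<Sum>\<tau>\<in>hc_configs k (ball_V k n). measure ?N (?E \<tau>))"
      using E by (intro N.finite_measure_finite_Union finite_hc_configs finite_ball_V)
        (auto simp: disjoint_family_on_def)
    also have "\<dots> = ?Z * ?C"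
      using prob_thinned_cylinder[OF bl lam] by (simp add: sum_distrib_right)
    finally have "?C = 1 / ?Z" by (metis mult_zero_left nonzero_eq_divide_eq mult.commute zero_neq_one)
    moreover have "{\<omega> \<in> space ?\<mu>. restrict \<omega> (ball_V k n) = \<sigma>} = cylinder k n {\<sigma>}"
      by (auto simp: cylinder_def space_config_space)
    ultimately show ?thesis
      using prob_thinned_cylinder[OF bl lam \<sigma>]
      by (simp add: measure_distr[OF thinned_measurable single_cylinder_measurable[OF \<sigma>]]
          event finite_volume_def)
  qed
  then show "gibbs_measure k lam z ?\<mu>"
    unfolding gibbs_measure_def
    using bl N.prob_space_distr[OF thinned_measurable] by auto
qed

section \<open>The level sets of the activity\<close>

text \<open>With \<open>p = r + 1\<close> and \<open>q = m + 1\<close>, this is the activity \<open>lam\<close> at which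
  \<open>h = a / lam\<close>, \<open>l = 1 / (lam * a)\<close> solves the alternating system.\<close>

definition activity :: "nat \<Rightarrow> nat \<Rightarrow> real \<Rightarrow> real" where
  "activity p q a = (1 + a) ^ (p + q) / a ^ p"

lemma activity_pos: "a > 0 \<Longrightarrow> activity p q a > 0"
  by (simp add: activity_def)

lemma ln_activity: "a > 0 \<Longrightarrow> ln (activity p q a) = real (p + q) * ln (1 + a) - real p * ln a"
  by (simp add: activity_def ln_div ln_realpow)

lemma has_derivative_ln_activity:
  assumes "a > 0"
  shows "((\<lambda>a. ln (activity p q a)) has_real_derivative (real q * a - real p) / (a * (1 + a))) (at a)"
proof -
  have "((\<lambda>a. real (p + q) * ln (1 + a) - real p * ln a) has_real_derivative
      (real q * a - real p) / (a * (1 + a))) (at a)"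
  proof -
    have "((\<lambda>a. real (p + q) * ln (1 + a) - real p * ln a) has_real_derivative
        real (p + q) * (1 / (1 + a)) - real p * (1 / a)) (at a)"
      using assms by (auto intro!: derivative_eq_intros)
    moreover have "1 + a \<noteq> 0" using assms by simp
    then have "real (p + q) * (1 / (1 + a)) - real p * (1 / a) = (real q * a - real p) / (a * (1 + a))"
      using assms by (simp add: divide_simps) (simp add: algebra_simps)
    ultimately show ?thesis by simp
  qed
  then show ?thesis
    by (rule has_field_derivative_transform_within_open[where S = "{0<..}"])
       (use assms in \<open>auto simp: ln_activity\<close>)
qed

lemma continuous_on_ln_activity:
  "0 < a \<Longrightarrow> continuous_on {a..b} (\<lambda>a. ln (activity p q a))"
  by (intro continuous_at_imp_continuous_on ballI DERIV_isCont[OF has_derivative_ln_activity]) auto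

lemma continuous_on_activity: "0 < a \<Longrightarrow> continuous_on {a..b} (activity p q)"
  unfolding activity_def by (intro continuous_intros) auto

text \<open>The numerator \<open>q * a - p\<close> of the logarithmic derivative changes sign at \<open>p / q\<close>, so the activity
  falls up to that point and rises afterwards.\<close>

lemma activity_strict_decreasing:
  assumes "q > 0" "0 < a" "a < b" "b \<le> real p / real q"
  shows "activity p q b < activity p q a"
proof -
  have "ln (activity p q b) < ln (activity p q a)"
  proof (rule DERIV_neg_imp_decreasing_open[OF \<open>a < b\<close> _ continuous_on_ln_activity[OF \<open>0 < a\<close>]])
    fix x assume x: "a < x" "x < b"
    then have "x < real p / real q" using assms by linarith
    then have "real q * x < real p" using assms by (simp add: field_simps)
    then have "(real q * x - real p) / (x * (1 + x)) < 0"
      using x assms by (intro divide_neg_pos) auto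
    then show "\<exists>y. DERIV (\<lambda>a. ln (activity p q a)) x :> y \<and> y < 0"
      using has_derivative_ln_activity[of x p q] x assms by fastforce
  qed
  then show ?thesis using assms by (simp add: activity_pos)
qed

lemma activity_strict_increasing:
  assumes "q > 0" "p > 0" "real p / real q \<le> a" "a < b"
  shows "activity p q a < activity p q b"
proof -
  have pos: "0 < a" using assms by (meson divide_pos_pos less_le_trans of_nat_0_less_iff)
  have "ln (activity p q a) < ln (activity p q b)"
  proof (rule DERIV_pos_imp_increasing_open[OF \<open>a < b\<close> _ continuous_on_ln_activity[OF pos]])
    fix x assume x: "a < x" "x < b"
    then have "real p / real q < x" using assms by linarith
    then have "real p < real q * x" using assms by (simp add: field_simps)
    then have "(real q * x - real p) / (x * (1 + x)) > 0"
      using x pos by (intro divide_pos_pos) auto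
    then show "\<exists>y. DERIV (\<lambda>a. ln (activity p q a)) x :> y \<and> y > 0"
      using has_derivative_ln_activity[of x p q] x pos by fastforce
  qed
  then show ?thesis using assms pos by (simp add: activity_pos)
qed

lemma activity_ge_critical:
  assumes "p > 0" "q > 0" "a > 0"
  shows "activity p q (p / q) \<le> activity p q a"
    and "activity p q a = activity p q (p / q) \<longleftrightarrow> a = p / q"
proof -
  have "a \<noteq> p / q \<Longrightarrow> activity p q (p / q) < activity p q a"
    using activity_strict_decreasing[of q a "p / q" p] activity_strict_increasing[of q p "p / q" a] assms
    by (cases "a < p / q") auto
  then show "activity p q (p / q) \<le> activity p q a"
    and "activity p q a = activity p q (p / q) \<longleftrightarrow> a = p / q"
    by (cases "a = p / q"; force)+
qed

text \<open>This bound and the next one make the activity arbitrarily large near \<open>0\<close> and near infinity.\<close>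

lemma activity_ge_inverse:
  assumes "p > 0" "0 < a" "a \<le> 1"
  shows "1 / a \<le> activity p q a"
proof -
  have "a ^ p \<le> a ^ 1" using assms by (intro power_decreasing) auto
  moreover have "1 \<le> (1 + a) ^ (p + q)" using assms by simp
  ultimately show ?thesis unfolding activity_def using assms by (intro frac_le) auto
qed

lemma activity_ge_self:
  assumes "q > 0" "1 \<le> a"
  shows "a \<le> activity p q a"
proof -
  have "a = a ^ 1" by simp
  also have "\<dots> \<le> a ^ q" using assms by (intro power_increasing) auto
  also have "\<dots> = a ^ (p + q) / a ^ p" using assms by (simp add: power_add)
  also have "\<dots> \<le> activity p q a"
    unfolding activity_def using assms by (intro divide_right_mono power_mono) auto
  finally show ?thesis .
qed

lemma activity_two_preimages:
  assumes p: "p > 0" and q: "q > 0" and lam: "lam > activity p q (p / q)"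
  shows "\<exists>a b. a < b \<and> {x. 0 < x \<and> activity p q x = lam} = {a, b}"
proof -
  define c where "c = real p / real q"
  have c: "c > 0" using p q by (simp add: c_def)
  have lam0: "lam > 0" and lamc: "lam > activity p q c"
    using lam activity_pos[OF c, of p q] by (auto simp: c_def)
  \<comment> \<open>The point \<open>A\<close> lies left of the minimum and has activity at least \<open>lam\<close>; \<open>B\<close> below does so on the right.\<close>
  define A where "A = min c (min 1 (1 / lam))"
  have A: "0 < A" "A \<le> c" "A \<le> 1" "A \<le> 1 / lam" using c lam0 by (auto simp: A_def)
  have "lam \<le> 1 / A" using A lam0 by (simp add: field_simps)
  also have "\<dots> \<le> activity p q A" using activity_ge_inverse p A by simp
  finally obtain a where a: "A \<le> a" "a \<le> c" "activity p q a = lam"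
    using IVT2'[of "activity p q" c lam A] continuous_on_activity[OF A(1)] A lamc by auto
  define B where "B = max c (max 1 lam)"
  have B: "c \<le> B" "1 \<le> B" "lam \<le> B" by (auto simp: B_def)
  have "lam \<le> activity p q B" using activity_ge_self[of q B p] q B by linarith
  then obtain b where b: "c \<le> b" "b \<le> B" "activity p q b = lam"
    using IVT'[of "activity p q" c lam B] continuous_on_activity[OF c] B lamc by auto
  have ac: "0 < a" "a < c" "c < b"
    using a b A lamc by (auto simp: order_less_le)
  have "x = a \<or> x = b" if x: "0 < x" "activity p q x = lam" for x
  proof (cases "x \<le> c")
    case True
    then show ?thesis
      using activity_strict_decreasing[OF q, of x a p] activity_strict_decreasing[OF q, of a x p]
        x a ac by (cases x a rule: linorder_cases) (auto simp: c_def)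
  next
    case False
    then show ?thesis
      using activity_strict_increasing[OF q p, of x b] activity_strict_increasing[OF q p, of b x]
        x b ac by (cases x b rule: linorder_cases) (auto simp: c_def)
  qed
  then have "{x. 0 < x \<and> activity p q x = lam} = {a, b}" using a b ac by auto
  moreover have "a < b" using ac by simp
  ultimately show ?thesis by blast
qed

lemma activity_one: "activity p q 1 = 2 ^ (p + q)"
  by (simp add: activity_def)

section \<open>The solutions of the alternating system\<close>

lemma ex1_translation_invariant_solution:
  fixes lam :: real
  assumes "lam > 0"
  shows "\<exists>!c. c > 0 \<and> c = 1 / (1 + lam * c) ^ k"
proof -
  define f where "f c = c * (1 + lam * c) ^ k" for c
  have eq: "c = 1 / (1 + lam * c) ^ k \<longleftrightarrow> f c = 1" if "c > 0" for c
  proof -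
    have "1 + lam * c > 0" using assms that by (simp add: add_pos_pos)
    then show ?thesis by (simp add: f_def nonzero_eq_divide_eq)
  qed
  have mono: "f a < f b" if "0 < a" "a < b" for a b
    unfolding f_def using that assms
    by (intro mult_less_le_imp_less power_mono) (auto simp: add_pos_pos mult_pos_pos)
  have "1 \<le> f 1" using assms by (simp add: f_def)
  then obtain c where "0 \<le> c" "f c = 1"
    using IVT'[of f 0 1 1] by (force simp: f_def intro!: continuous_intros)
  moreover have "c \<noteq> 0" using \<open>f c = 1\<close> by (auto simp: f_def)
  ultimately have c: "c > 0" "f c = 1" by auto
  show ?thesis
  proof (rule ex1I[of _ c])
    show "c > 0 \<and> c = 1 / (1 + lam * c) ^ k" using c eq by blast
    fix d assume "d > 0 \<and> d = 1 / (1 + lam * d) ^ k"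
    then have "d > 0" "f d = 1" using eq by blast+
    then show "d = c" using mono[of c d] mono[of d c] c by (cases c d rule: linorder_cases) auto
  qed
qed

lemma agm_solution_diagonal:
  assumes "m + r + 2 = k"
  shows "agm_solution k m r lam h h \<longleftrightarrow> h > 0 \<and> h = 1 / (1 + lam * h) ^ k"
proof -
  have "m + (k - m) = k" "r + (k - r) = k" using assms by auto
  then show ?thesis unfolding agm_solution_def by (auto simp flip: power_add)
qed

text \<open>Dividing the two equations leaves \<open>h * (1 + lam * l)\<^sup>2 = l * (1 + lam * h)\<^sup>2\<close>, because
  \<open>m + r = k - 2\<close> makes the exponents in the two equations differ by exactly two. The difference of
  the two sides factors into \<open>h - l\<close> and \<open>1 - lam\<^sup>2 * h * l\<close>.\<close>

lemma agm_solution_quotient: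
  assumes k: "m + r + 2 = k" and lam: "lam > 0" and sol: "agm_solution k m r lam h l"
  shows "h = l \<or> lam\<^sup>2 * h * l = 1"
proof -
  have h: "h > 0" and l: "l > 0" using sol by (auto simp: agm_solution_def)
  define u v where "u = 1 + lam * h" and "v = 1 + lam * l"
  have uv: "u > 0" "v > 0" using lam h l by (auto simp: u_def v_def add_pos_pos)
  have km: "k - m = r + 2" "k - r = m + 2" using k by auto
  have 1: "h * (u ^ m * v ^ r * v\<^sup>2) = 1" and 2: "l * (u ^ m * v ^ r * u\<^sup>2) = 1"
    using sol uv unfolding agm_solution_def km u_def[symmetric] v_def[symmetric]
    by (auto simp: nonzero_eq_divide_eq power_add power2_eq_square mult_ac)
  have "(u ^ m * v ^ r) * (h * v\<^sup>2) = (u ^ m * v ^ r) * (l * u\<^sup>2)"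
    using 1 2 by (simp add: mult_ac)
  then have "h * v\<^sup>2 = l * u\<^sup>2" using uv by simp
  then have "(h - l) * (1 - lam\<^sup>2 * h * l) = 0"
    unfolding u_def v_def by (simp add: power2_eq_square algebra_simps)
  then show ?thesis by auto
qed

text \<open>On the branch \<open>lam\<^sup>2 * h * l = 1\<close> both equations become the same equation for \<open>a = lam * h\<close>.\<close>

lemma agm_solution_reciprocal:
  assumes k: "m + r + 2 = k" and lam: "lam > 0" and a: "a > 0"
  shows "agm_solution k m r lam (a / lam) (1 / (lam * a)) \<longleftrightarrow> activity (r + 1) (m + 1) a = lam"
proof -
  have km: "k - m = r + 2" "k - r = m + 2" using k by auto
  have u: "1 + lam * (a / lam) = 1 + a" and v: "1 + lam * (1 / (lam * a)) = (1 + a) / a"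
    using lam a by (auto simp: field_simps)
  have pos: "a / lam > 0" "1 / (lam * a) > 0" "1 + a > 0" using lam a by auto
  have act: "activity (r + 1) (m + 1) a = lam \<longleftrightarrow> (1 + a) ^ (m + r + 2) = lam * a ^ (r + 1)"
    using a by (simp add: activity_def nonzero_divide_eq_eq add_ac)
  have 1: "a / lam = 1 / (w ^ m * (w / a) ^ (r + 2)) \<longleftrightarrow> w ^ (m + r + 2) = lam * a ^ (r + 1)"
    if "w > 0" for w
    using lam a that by (simp add: power_divide field_simps power_add power2_eq_square)
  have 2: "1 / (lam * a) = 1 / ((w / a) ^ r * w ^ (m + 2)) \<longleftrightarrow> w ^ (m + r + 2) = lam * a ^ (r + 1)"
    if "w > 0" for w
    using lam a that by (simp add: power_divide field_simps power_add power2_eq_square)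
  show ?thesis unfolding agm_solution_def km u v 1[OF pos(3)] 2[OF pos(3)] act using pos by simp
qed

text \<open>The value \<open>a = 1\<close> of the second branch is the intersection with the diagonal and is left out,
  so that each solution is listed once.\<close>

lemma agm_solutions:
  assumes k: "m + r + 2 = k" and lam: "lam > 0"
    and c: "c > 0" "c = 1 / (1 + lam * c) ^ k"
  shows "{(h, l). agm_solution k m r lam h l} =
    insert (c, c) ((\<lambda>a. (a / lam, 1 / (lam * a))) `
      {a. 0 < a \<and> a \<noteq> 1 \<and> activity (r + 1) (m + 1) a = lam})"
proof (intro equalityI subsetI)
  fix x assume "x \<in> {(h, l). agm_solution k m r lam h l}"
  then obtain h l where x: "x = (h, l)" and sol: "agm_solution k m r lam h l" by auto
  have pos: "h > 0" "l > 0" using sol by (auto simp: agm_solution_def)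
  show "x \<in> insert (c, c) ((\<lambda>a. (a / lam, 1 / (lam * a))) `
      {a. 0 < a \<and> a \<noteq> 1 \<and> activity (r + 1) (m + 1) a = lam})"
  proof (cases "h = l")
    case True
    then have "h = c"
      using sol agm_solution_diagonal[OF k] ex1_translation_invariant_solution[OF lam, of k] c by blast
    then show ?thesis using True x by simp
  next
    case False
    then have hl: "lam\<^sup>2 * h * l = 1" using agm_solution_quotient[OF k lam sol] by simp
    define a where "a = lam * h"
    have a: "a > 0" "h = a / lam" using pos lam by (auto simp: a_def)
    have l: "l = 1 / (lam * a)" using hl lam pos by (simp add: a_def field_simps power2_eq_square)
    have "a \<noteq> 1" using False a l by auto
    moreover have "activity (r + 1) (m + 1) a = lam"
      using sol agm_solution_reciprocal[OF k lam a(1)] unfolding a(2) l by simp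
    ultimately show ?thesis unfolding x using a l by blast
  qed
next
  fix x assume "x \<in> insert (c, c) ((\<lambda>a. (a / lam, 1 / (lam * a))) `
      {a. 0 < a \<and> a \<noteq> 1 \<and> activity (r + 1) (m + 1) a = lam})"
  then show "x \<in> {(h, l). agm_solution k m r lam h l}"
    using agm_solution_diagonal[OF k, of lam c] agm_solution_reciprocal[OF k lam] c by auto
qed

section \<open>From solutions to measures\<close>

lemma ex1_gibbs_measure:
  assumes "boundary_law k lam z" "lam > 0"
  shows "\<exists>!\<mu>. gibbs_measure k lam z \<mu>"
  using gibbs_measure_exists[OF assms] gibbs_measure_unique by blast

text \<open>Both values \<open>h\<close> and \<open>l\<close> are taken by the boundary law, at the root or at one of its
  successors, so it determines the solution.\<close>

lemma arrangement_both_symbols: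
  assumes s: "arrangement k m r s" and "m < k" "r < k"
  shows "\<exists>x\<in>vertices k. s x = H" "\<exists>x\<in>vertices k. s x = L"
proof -
  have root: "[] \<in> vertices k" by (simp add: vertices_def)
  have child: "y \<in> vertices k" if "y \<in> successors k []" for y
    using that root by (auto simp: successors_def Cons_in_vertices)
  have "(\<exists>x\<in>vertices k. s x = H) \<and> (\<exists>x\<in>vertices k. s x = L)"
  proof (cases "s []")
    case H
    then have "card {y \<in> successors k []. s y = L} > 0"
      using s root \<open>m < k\<close> by (simp add: arrangement_def)
    then show ?thesis using root child H by (auto simp: card_gt_0_iff)
  next
    case L
    then have "card {y \<in> successors k []. s y = H} > 0"
      using s root \<open>r < k\<close> by (simp add: arrangement_def)
    then show ?thesis using root child L by (auto simp: card_gt_0_iff)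
  qed
  then show "\<exists>x\<in>vertices k. s x = H" "\<exists>x\<in>vertices k. s x = L" by auto
qed

lemma prod_symbols:
  fixes f g :: real
  assumes "finite A"
  shows "(\<Prod>y\<in>A. case s y of H \<Rightarrow> f | L \<Rightarrow> g) = f ^ card {y \<in> A. s y = H} * g ^ card {y \<in> A. s y = L}"
proof -
  have "(\<Prod>y\<in>A. case s y of H \<Rightarrow> f | L \<Rightarrow> g) =
      (\<Prod>y\<in>A. (if s y = H then f else 1) * (if s y = L then g else 1))"
    by (intro prod.cong) (auto split: symbol.split intro: symbol.exhaust)
  then show ?thesis using assms by (simp add: prod.distrib prod.inter_filter[symmetric])
qed

lemma boundary_law_arrangement:
  assumes s: "arrangement k m r s" and sol: "agm_solution k m r lam h l"
  shows "boundary_law k lam (\<lambda>x. case s x of H \<Rightarrow> h | L \<Rightarrow> l)"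
  unfolding boundary_law_def
proof (intro ballI conjI)
  fix x assume x: "x \<in> vertices k"
  show "(case s x of H \<Rightarrow> h | L \<Rightarrow> l) > 0"
    using sol by (auto simp: agm_solution_def split: symbol.split)
  let ?u = "inverse (1 + lam * h)" and ?v = "inverse (1 + lam * l)"
  have "(\<Prod>y\<in>successors k x. inverse (1 + lam * (case s y of H \<Rightarrow> h | L \<Rightarrow> l))) =
      (\<Prod>y\<in>successors k x. case s y of H \<Rightarrow> ?u | L \<Rightarrow> ?v)"
    by (intro prod.cong) (auto split: symbol.split)
  also have "\<dots> = ?u ^ card {y \<in> successors k x. s y = H} * ?v ^ card {y \<in> successors k x. s y = L}"
    by (rule prod_symbols[OF finite_successors])
  also have "\<dots> = (case s x of H \<Rightarrow> h | L \<Rightarrow> l)"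
  proof (cases "s x")
    case H
    then have "card {y \<in> successors k x. s y = H} = m" "card {y \<in> successors k x. s y = L} = k - m"
      using s x by (auto simp: arrangement_def)
    moreover have "h = ?u ^ m * ?v ^ (k - m)"
      using sol by (simp add: agm_solution_def divide_simps)
    ultimately show ?thesis using H by simp
  next
    case L
    then have "card {y \<in> successors k x. s y = L} = r" "card {y \<in> successors k x. s y = H} = k - r"
      using s x by (auto simp: arrangement_def)
    moreover have "l = ?v ^ r * ?u ^ (k - r)"
      using sol by (simp add: agm_solution_def divide_simps)
    ultimately show ?thesis using L by (simp add: mult.commute)
  qed
  finally show "(case s x of H \<Rightarrow> h | L \<Rightarrow> l) =
      (\<Prod>y\<in>successors k x. inverse (1 + lam * (case s y of H \<Rightarrow> h | L \<Rightarrow> l)))" by simp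
qed

lemma boundary_law_constant:
  assumes "k > 0" "c > 0"
  shows "boundary_law k lam (\<lambda>_. c) \<longleftrightarrow> c = 1 / (1 + lam * c) ^ k"
proof -
  have "card (successors k x) = k" for x
    by (simp add: successors_def card_image inj_on_def)
  moreover have "[] \<in> vertices k" by (simp add: vertices_def)
  ultimately show ?thesis
    using assms by (auto simp: boundary_law_def inverse_eq_divide power_one_over)
qed

text \<open>The measures correspond bijectively to the solutions: existence and uniqueness give a map from
  solutions to measures, and it is injective since the measure determines its boundary law. All
  that is left to decide is the number of points \<open>a \<noteq> 1\<close> in a level set of the activity.\<close>

lemma AGM_structure:
  assumes k: "m + r + 2 = k" and lam: "lam > 0" and s: "arrangement k m r s"
  obtains \<mu>0 N where
    "TIGM k lam = {\<mu>0}"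
    "AGM k m r s lam = insert \<mu>0 (N ` {a. 0 < a \<and> a \<noteq> 1 \<and> activity (r + 1) (m + 1) a = lam})"
    "inj_on N {a. 0 < a \<and> a \<noteq> 1 \<and> activity (r + 1) (m + 1) a = lam}"
    "\<mu>0 \<notin> N ` {a. 0 < a \<and> a \<noteq> 1 \<and> activity (r + 1) (m + 1) a = lam}"
proof -
  let ?A = "{a. 0 < a \<and> a \<noteq> 1 \<and> activity (r + 1) (m + 1) a = lam}"
  let ?pt = "\<lambda>a. (a / lam, 1 / (lam * a))"
  let ?z = "\<lambda>(h, l) x. case s x of H \<Rightarrow> h | L \<Rightarrow> l"
  define Sol where "Sol = {(h, l). agm_solution k m r lam h l}"
  define M where "M p = (THE \<mu>. gibbs_measure k lam (?z p) \<mu>)" for p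
  obtain c where c: "c > 0" "c = 1 / (1 + lam * c) ^ k"
    using ex1_translation_invariant_solution[OF lam, of k] by blast
  have Sol: "Sol = insert (c, c) (?pt ` ?A)"
    unfolding Sol_def by (rule agm_solutions[OF k lam c])
  have bl: "boundary_law k lam (?z p)" if "p \<in> Sol" for p
    using that boundary_law_arrangement[OF s] by (auto simp: Sol_def)
  have M: "gibbs_measure k lam (?z p) \<mu> \<longleftrightarrow> \<mu> = M p" if "p \<in> Sol" for p \<mu>
    unfolding M_def using theI'[OF ex1_gibbs_measure[OF bl[OF that] lam]] gibbs_measure_unique by blast
  have AGM: "AGM k m r s lam = M ` Sol"
  proof -
    have "AGM k m r s lam = {\<mu>. \<exists>p\<in>Sol. gibbs_measure k lam (?z p) \<mu>}"
      by (auto simp: AGM_def Sol_def)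
    then show ?thesis using M by blast
  qed
  obtain xH xL where x: "xH \<in> vertices k" "s xH = H" "xL \<in> vertices k" "s xL = L"
    using arrangement_both_symbols[OF s] k by auto
  have inj: "inj_on M Sol"
  proof (rule inj_onI)
    fix p q assume pq: "p \<in> Sol" "q \<in> Sol" "M p = M q"
    have "?z p y = ?z q y" if "y \<in> vertices k" for y
      using gibbs_measure_determines_boundary_law[OF lam _ _ that, of "?z p" "M p" "?z q"] M pq by auto
    \<comment> \<open>Evaluate at one vertex of each symbol.\<close>
    from this[OF x(1)] this[OF x(3)] show "p = q"
      using x by (auto simp: prod_eq_iff split: prod.splits)
  qed
  have diag: "?z (h, h) = (\<lambda>_. h)" for h by (auto split: symbol.split)
  have "TIGM k lam = {M (c, c)}"
  proof -
    have "c' = c" if "gibbs_measure k lam (\<lambda>_. c') \<mu>" for c' \<mu>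
    proof -
      have "boundary_law k lam (\<lambda>_. c')" "c' > 0"
        using that x(1) by (auto simp: gibbs_measure_def boundary_law_def)
      then have "c' = 1 / (1 + lam * c') ^ k" using boundary_law_constant k by simp
      then show ?thesis
        using ex1_translation_invariant_solution[OF lam, of k] c \<open>c' > 0\<close> by blast
    qed
    moreover have "gibbs_measure k lam (\<lambda>_. c) \<mu> \<longleftrightarrow> \<mu> = M (c, c)" for \<mu>
      using M[of "(c, c)" \<mu>] diag[of c] Sol by simp
    ultimately show ?thesis unfolding TIGM_def by blast
  qed
  moreover have "AGM k m r s lam = insert (M (c, c)) ((M \<circ> ?pt) ` ?A)"
    unfolding AGM Sol by (simp add: image_image)
  moreover have "inj_on (M \<circ> ?pt) ?A"
  proof (rule comp_inj_on)
    show "inj_on ?pt ?A" using lam by (auto simp: inj_on_def)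
    show "inj_on M (?pt ` ?A)" using inj by (rule inj_on_subset) (auto simp: Sol)
  qed
  moreover have "M (c, c) \<notin> (M \<circ> ?pt) ` ?A"
  proof
    assume "M (c, c) \<in> (M \<circ> ?pt) ` ?A"
    then obtain a where a: "a \<in> ?A" "M (c, c) = M (?pt a)" by auto
    then have "(c, c) = ?pt a" using inj_onD[OF inj a(2)] Sol by auto
    then have "a / lam = 1 / (lam * a)" by simp
    then have "a * a = 1" using lam a(1) by (simp add: field_simps)
    then have "a = 1" using a(1) square_eq_1_iff[of a] by auto
    then show False using a(1) by simp
  qed
  ultimately show thesis by (rule that)
qed

theorem theorem6:
  fixes k m r :: nat
  assumes "k \<ge> 2" and "m + r = k - 2"
  shows "\<exists>lam_cr::real. lam_cr > 0 \<and> (\<forall>s. arrangement k m r s \<longrightarrow>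
    (\<forall>lam. 0 < lam \<and> lam < lam_cr \<longrightarrow>
       (\<exists>\<mu>0. TIGM k lam = {\<mu>0} \<and> AGM k m r s lam = {\<mu>0})) \<and>
    (m = r \<longrightarrow>
       (\<exists>\<mu>0. TIGM k lam_cr = {\<mu>0} \<and> AGM k m r s lam_cr = {\<mu>0})) \<and>
    (m \<noteq> r \<longrightarrow>
       (\<exists>\<mu> \<in> AGM k m r s lam_cr. \<mu> \<notin> TIGM k lam_cr)) \<and>
    (\<forall>lam. lam > lam_cr \<and> lam \<noteq> 2 ^ k \<longrightarrow>
       (\<exists>\<mu>0 \<mu>1 \<mu>2. distinct [\<mu>0, \<mu>1, \<mu>2] \<and> TIGM k lam = {\<mu>0} \<and>
          AGM k m r s lam = {\<mu>0, \<mu>1, \<mu>2} \<and> \<mu>1 \<notin> TIGM k lam \<and> \<mu>2 \<notin> TIGM k lam)) \<and>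
    (2 ^ k > lam_cr \<longrightarrow>
       (\<exists>\<mu>0 \<mu>1. \<mu>0 \<noteq> \<mu>1 \<and> TIGM k (2 ^ k) = {\<mu>0} \<and>
          AGM k m r s (2 ^ k) = {\<mu>0, \<mu>1} \<and> \<mu>1 \<notin> TIGM k (2 ^ k))))"
proof -
  have k: "m + r + 2 = k" using assms by simp
  let ?f = "activity (r + 1) (m + 1)"
  let ?A = "\<lambda>lam. {a. 0 < a \<and> a \<noteq> 1 \<and> ?f a = lam}"
  define ac where "ac = real (r + 1) / real (m + 1)"
  define lam_cr where "lam_cr = ?f ac"
  have ac: "ac > 0" by (simp add: ac_def)
  have ac1: "ac = 1 \<longleftrightarrow> m = r" by (auto simp: ac_def)
  have cr: "lam_cr > 0" unfolding lam_cr_def using ac by (rule activity_pos)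
  have min: "lam_cr \<le> ?f a" "?f a = lam_cr \<longleftrightarrow> a = ac" if "a > 0" for a
    using activity_ge_critical[of "r + 1" "m + 1" a] that by (simp_all add: lam_cr_def ac_def)
  have f1: "?f 1 = 2 ^ k"
  proof -
    have "(r + 1) + (m + 1) = k" using k by simp
    then show ?thesis by (simp only: activity_one)
  qed
  have below: "?A lam = {}" if "lam < lam_cr" for lam
    using min(1) that by force
  have at: "?A lam_cr = {ac} - {1}" using min(2) ac by auto
  have above: "\<exists>a b. a < b \<and> {x. 0 < x \<and> ?f x = lam} = {a, b}" if "lam > lam_cr" for lam
    using activity_two_preimages[of "r + 1" "m + 1" lam] that by (simp add: lam_cr_def ac_def)
  show ?thesis
  proof (intro exI[of _ lam_cr] conjI allI impI cr; (elim conjE)?)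
    fix s lam assume s: "arrangement k m r s" and lam: "0 < lam" "lam < lam_cr"
    obtain \<mu>0 N where "TIGM k lam = {\<mu>0}" "AGM k m r s lam = insert \<mu>0 (N ` ?A lam)"
      "inj_on N (?A lam)" "\<mu>0 \<notin> N ` ?A lam"
      by (rule AGM_structure[OF k lam(1) s])
    then show "\<exists>\<mu>0. TIGM k lam = {\<mu>0} \<and> AGM k m r s lam = {\<mu>0}"
      unfolding below[OF lam(2)] by simp
  next
    fix s assume s: "arrangement k m r s" and mr: "m = r"
    have A: "?A lam_cr = {}" unfolding at using ac1 mr by simp
    obtain \<mu>0 N where "TIGM k lam_cr = {\<mu>0}" "AGM k m r s lam_cr = insert \<mu>0 (N ` ?A lam_cr)"
      "inj_on N (?A lam_cr)" "\<mu>0 \<notin> N ` ?A lam_cr"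
      by (rule AGM_structure[OF k cr s])
    then show "\<exists>\<mu>0. TIGM k lam_cr = {\<mu>0} \<and> AGM k m r s lam_cr = {\<mu>0}"
      unfolding A by simp
  next
    fix s assume s: "arrangement k m r s" and mr: "m \<noteq> r"
    have A: "?A lam_cr = {ac}" unfolding at using ac1 mr by auto
    obtain \<mu>0 N where "TIGM k lam_cr = {\<mu>0}" "AGM k m r s lam_cr = insert \<mu>0 (N ` ?A lam_cr)"
      "inj_on N (?A lam_cr)" "\<mu>0 \<notin> N ` ?A lam_cr"
      by (rule AGM_structure[OF k cr s])
    then show "\<exists>\<mu> \<in> AGM k m r s lam_cr. \<mu> \<notin> TIGM k lam_cr"
      unfolding A by auto
  next
    fix s lam assume s: "arrangement k m r s" and lam: "lam > lam_cr" "lam \<noteq> 2 ^ k"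
    obtain a b where ab: "a < b" "{x. 0 < x \<and> ?f x = lam} = {a, b}" using above[OF lam(1)] by blast
    \<comment> \<open>The point \<open>1\<close> belongs to the level set of \<open>2 ^ k\<close> alone.\<close>
    have "?A lam = {x. 0 < x \<and> ?f x = lam}" using lam(2) f1 by auto
    then have A: "?A lam = {a, b}" using ab(2) by simp
    have lam0: "lam > 0" using lam cr by simp
    obtain \<mu>0 N where "TIGM k lam = {\<mu>0}" "AGM k m r s lam = insert \<mu>0 (N ` ?A lam)"
      "inj_on N (?A lam)" "\<mu>0 \<notin> N ` ?A lam"
      by (rule AGM_structure[OF k lam0 s])
    then show "\<exists>\<mu>0 \<mu>1 \<mu>2. distinct [\<mu>0, \<mu>1, \<mu>2] \<and> TIGM k lam = {\<mu>0} \<and>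
          AGM k m r s lam = {\<mu>0, \<mu>1, \<mu>2} \<and> \<mu>1 \<notin> TIGM k lam \<and> \<mu>2 \<notin> TIGM k lam"
      unfolding A using ab(1)
      by (rule_tac x = \<mu>0 in exI, rule_tac x = "N a" in exI, rule_tac x = "N b" in exI) auto
  next
    fix s assume s: "arrangement k m r s" and lam: "2 ^ k > lam_cr"
    obtain a b where ab: "a < b" "{x. 0 < x \<and> ?f x = 2 ^ k} = {a, b}" using above[OF lam] by blast
    \<comment> \<open>At this activity one of the two points is \<open>1\<close>, that is, the translation-invariant solution again.\<close>
    have "1 \<in> {a, b}" unfolding ab(2)[symmetric] using f1 by simp
    moreover have "?A (2 ^ k) = {a, b} - {1}" unfolding ab(2)[symmetric] by auto
    ultimately obtain a' where A: "?A (2 ^ k) = {a'}" using ab(1) by auto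
    have lam0: "(0::real) < 2 ^ k" by simp
    obtain \<mu>0 N where "TIGM k (2 ^ k) = {\<mu>0}" "AGM k m r s (2 ^ k) = insert \<mu>0 (N ` ?A (2 ^ k))"
      "inj_on N (?A (2 ^ k))" "\<mu>0 \<notin> N ` ?A (2 ^ k)"
      by (rule AGM_structure[OF k lam0 s])
    then show "\<exists>\<mu>0 \<mu>1. \<mu>0 \<noteq> \<mu>1 \<and> TIGM k (2 ^ k) = {\<mu>0} \<and>
          AGM k m r s (2 ^ k) = {\<mu>0, \<mu>1} \<and> \<mu>1 \<notin> TIGM k (2 ^ k)"
      unfolding A by (rule_tac x = \<mu>0 in exI, rule_tac x = "N a'" in exI) auto
  qed
qed

end
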